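(* Let $H\in \mathrm{Sym}^2(A)$ be a Koszul-Vinberg structure on a left-symmetric algebroid $(A,\cdot_A,a_A)$ and let $\mathfrak B\in \mathrm{Sym}^2(A^* )$. Then $(H,\mathfrak B)$ is a $\mathrm{KV\Omega}$-structure if and only if $\mathfrak B$ is a $2$-cocycle (i.e. $\delta_A\mathfrak B=0$) and $\mathfrak B$ is a complementary symmetric $2$-tensor for $H$.
   Context: Left-symmetric algebroids. A left-symmetric algebroid $(A,\cdot_A,a_A)$ is a smooth real vector bundle $A\to M$ with an $\mathbb R$-bilinear operation $\cdot_A$ on $\Gamma(A)$ such that $x\cdot_A(y\cdot_A z)-(x\cdot_A y)\cdot_A z$ is symmetric in $x,y$, and a bundle map $a_A:A\to TM$ such that $x\cdot_A(fy)=f(x\cdot_A y)+a_A(x)(f)\,y$ and $(fx)\cdot_A y=f(x\cdot_A y)$ for $x,y\in\Gamma(A)$, $f\in C^\infty(M)$. Put $[x,y]_A=x\cdot_A y-y\cdot_A x$; $(A,[-,-]_A,a_A)$ is a Lie algebroid. Koszul-Vinberg structures. $\mathrm{Sym}^2(A)$ is the set of symmetric sections $H$ of $A\otimes A$; $H^\sharp:A^*\to A$ is $\langle H^\sharp(\alpha),\beta\rangle=H(\alpha,\beta)$. For $\alpha_i\in\Gamma(A^* )$, $$\begin{aligned}[\![ H,H]\!]_A(\alpha_1,\alpha_2,\alpha_3)=\ &a_A(H^\sharp(\alpha_1))\langle H^\sharp(\alpha_2),\alpha_3\rangle-a_A(H^\sharp(\alpha_2))\langle H^\sharp(\alpha_1),\alpha_3\rangle+\langle\alpha_1,H^\sharp(\alpha_2)\cdot_A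 H^\sharp(\alpha_3)\rangle\\&-\langle\alpha_2,H^\sharp(\alpha_1)\cdot_A H^\sharp(\alpha_3)\rangle-\langle\alpha_3,[H^\sharp(\alpha_1),H^\sharp(\alpha_2)]_A\rangle.\end{aligned}$$ $H$ is a Koszul-Vinberg structure if $[\![ H,H]\!]_A=0$. Product on $\Gamma(A^* )$. With $\langle\mathcal L_x\alpha,y\rangle=a_A(x)\langle\alpha,y\rangle-\langle\alpha,[x,y]_A\rangle$, $\langle R_x\alpha,y\rangle=-\langle\alpha,y\cdot_A x\rangle$, $\langle d_Af,x\rangle=a_A(x)(f)$, set $\alpha\cdot^{H^\sharp}\beta=\mathcal L_{H^\sharp(\alpha)}\beta-R_{H^\sharp(\beta)}\alpha-d_A(H(\alpha,\beta))$. If $H$ is a Koszul-Vinberg structure, $(A^*,\cdot^{H^\sharp},a_{A^*}=a_A\circ H^\sharp)$ is a left-symmetric algebroid (known). Cocycles. $\mathrm{Sym}^2(A^* )$ is the set of symmetric sections $\mathfrak B$ of $A^*\otimes A^*$; $\mathfrak B^\natural:A\to A^*$ is $\langle\mathfrak B^\natural(x),y\rangle=\mathfrak B(x,y)$. $\delta_A\mathfrak B(x,y,z)=a_A(x)\mathfrak B(y,z)-a_A(y)\mathfrak B(x,z)-\mathfrak B(y,x\cdot_A z)+\mathfrak B(x,y\cdot_A z)-\mathfrak B([x,y]_A,z)$; $\mathfrak B$ is a $2$-cocycle if $\delta_A\mathfrak B=0$. $\mathrm{KV\Omega}$-structure: a pair $(H,\mathfrak B)$ with $H$ a Koszul-Vinberg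 structure and $\mathfrak B\in \mathrm{Sym}^2(A^* )$ a $2$-cocycle such that $\mathfrak B_N$ is also a $2$-cocycle, where $N=H^\sharp\circ\mathfrak B^\natural$ and $\mathfrak B_N(x,y)=\mathfrak B(N(x),y)$. Complementary symmetric $2$-tensor for a Koszul-Vinberg structure $H$: an element $\mathfrak B\in \mathrm{Sym}^2(A^* )$ with $[\![\mathfrak B,\mathfrak B]\!]_{A^*}=0$, where, for $x_1,x_2,x_3\in\Gamma(A)$, $$\begin{aligned}[\![\mathfrak B,\mathfrak B]\!]_{A^*}(x_1,x_2,x_3)=\ &a_A(H^\sharp\mathfrak B^\natural(x_1))\langle\mathfrak B^\natural(x_2),x_3\rangle-a_A(H^\sharp\mathfrak B^\natural(x_2))\langle\mathfrak B^\natural(x_1),x_3\rangle+\langle x_1,\mathfrak B^\natural(x_2)\cdot^{H^\sharp}\mathfrak B^\natural(x_3)\rangle\\&-\langle x_2,\mathfrak B^\natural(x_1)\cdot^{H^\sharp}\mathfrak B^\natural(x_3)\rangle-\langle x_3,\mathfrak B^\natural(x_1)\cdot^{H^\sharp}\mathfrak B^\natural(x_2)-\mathfrak B^\natural(x_2)\cdot^{H^\sharp}\mathfrak B^\natural(x_1)\rangle,\end{aligned}$$ i.e. the formula defining $[\![ H,H]\!]_A$, applied to the left-symmetric algebroid $(A^*,\cdot^{H^\sharp},a_A\circ H^\sharp)$ and $\mathfrak B\in \mathrm{Sym}^2(A^* )$ (identifying $A^{**}=A$, with $\mathfrak B^\natural$ in the role of $H^\sharp$). *)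

theory Defs
  imports "HOL-Analysis.Analysis"
begin

section \<open>Smooth manifolds\<close>

text \<open>
  The model space is \<^const>\<open>Euclidean_space\<close> \<open>n\<close>, i.e. the sequences that vanish from index \<open>n\<close> on;
  this includes dimension \<open>0\<close>, which type-indexed vectors do not. Functions on an open set \<open>S\<close> of it
  are of class \<open>C\<^sup>k\<close> in the classical sense of iterated continuous partial derivatives; their values
  outside \<open>S\<close> are irrelevant.
\<close>

definition partial_deriv :: "nat \<Rightarrow> ((nat \<Rightarrow> real) \<Rightarrow> real) \<Rightarrow> (nat \<Rightarrow> real) \<Rightarrow> real" where
  "partial_deriv i f x = deriv (\<lambda>t. f (x(i := t))) (x i)"

primrec Ck_on :: "nat \<Rightarrow> nat \<Rightarrow> (nat \<Rightarrow> real) set \<Rightarrow> ((nat \<Rightarrow> real) \<Rightarrow> real) \<Rightarrow> bool" where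
  "Ck_on n 0 S f \<longleftrightarrow> continuous_map (subtopology (Euclidean_space n) S) euclideanreal f"
| "Ck_on n (Suc k) S f \<longleftrightarrow>
     continuous_map (subtopology (Euclidean_space n) S) euclideanreal f \<and>
     (\<forall>i<n. (\<forall>x\<in>S. (\<lambda>t. f (x(i := t))) differentiable at (x i)) \<and> Ck_on n k S (partial_deriv i f))"

definition smooth_Euclidean :: "nat \<Rightarrow> (nat \<Rightarrow> real) set \<Rightarrow> ((nat \<Rightarrow> real) \<Rightarrow> real) \<Rightarrow> bool" where
  "smooth_Euclidean n S f \<longleftrightarrow> (\<forall>k. Ck_on n k S f)"

text \<open>The points of a manifold form a whole type; a chart is a pair of its domain and its coordinate map.\<close>

record 'm manifold =
  mdim :: nat
  charts :: "('m set \<times> ('m \<Rightarrow> nat \<Rightarrow> real)) set"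

definition smooth_manifold ::
  "('m::{t2_space, second_countable_topology}, 'z) manifold_scheme \<Rightarrow> bool" where
  "smooth_manifold M \<longleftrightarrow>
     (\<Union>(fst ` charts M) = UNIV) \<and>
     (\<forall>(U, \<phi>)\<in>charts M. open U \<and> openin (Euclidean_space (mdim M)) (\<phi> ` U) \<and>
        homeomorphic_map (top_of_set U) (subtopology (Euclidean_space (mdim M)) (\<phi> ` U)) \<phi>) \<and>
     (\<forall>(U, \<phi>)\<in>charts M. \<forall>(V, \<psi>)\<in>charts M. \<forall>i<mdim M.
        smooth_Euclidean (mdim M) (\<phi> ` (U \<inter> V)) (\<lambda>x. \<psi> (inv_into U \<phi> x) i))"

text \<open>Smoothness of a real function on an open set \<open>W\<close> of a manifold.\<close>

definition smooth_fun_on ::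
  "('m::{t2_space, second_countable_topology}, 'z) manifold_scheme \<Rightarrow> 'm set \<Rightarrow> ('m \<Rightarrow> real) \<Rightarrow> bool" where
  "smooth_fun_on M W f \<longleftrightarrow>
     (\<forall>(U, \<phi>)\<in>charts M. smooth_Euclidean (mdim M) (\<phi> ` (U \<inter> W)) (\<lambda>x. f (inv_into U \<phi> x)))"

definition Cinf ::
  "('m::{t2_space, second_countable_topology}, 'z) manifold_scheme \<Rightarrow> ('m \<Rightarrow> real) set" where
  "Cinf M = {f. smooth_fun_on M UNIV f}"

text \<open>Tangent vectors at \<open>p\<close> are the derivations at \<open>p\<close> of \<^term>\<open>Cinf M\<close>; their values on functions
  that are not smooth are irrelevant.\<close>

definition tangent_space ::
  "('m::{t2_space, second_countable_topology}, 'z) manifold_scheme \<Rightarrow> 'm \<Rightarrow> (('m \<Rightarrow> real) \<Rightarrow> real) set" where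
  "tangent_space M p =
     {D. (\<forall>f\<in>Cinf M. \<forall>g\<in>Cinf M. D (\<lambda>q. f q + g q) = D f + D g) \<and>
         (\<forall>f\<in>Cinf M. \<forall>c. D (\<lambda>q. c * f q) = c * D f) \<and>
         (\<forall>f\<in>Cinf M. \<forall>g\<in>Cinf M. D (\<lambda>q. f q * g q) = f p * D g + g p * D f)}"

definition smooth_vector_field_on ::
  "('m::{t2_space, second_countable_topology}, 'z) manifold_scheme
     \<Rightarrow> 'm set \<Rightarrow> ('m \<Rightarrow> ('m \<Rightarrow> real) \<Rightarrow> real) \<Rightarrow> bool" where
  "smooth_vector_field_on M W X \<longleftrightarrow>
     (\<forall>p\<in>W. X p \<in> tangent_space M p) \<and> (\<forall>f\<in>Cinf M. smooth_fun_on M W (\<lambda>p. X p f))"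


section \<open>Smooth real vector bundles\<close>

text \<open>
  The fibre over \<open>p\<close> is a linear subspace \<open>fibre A p\<close> of an ambient real vector space without further
  structure (every family of vector spaces is of this form, up to isomorphism: take their direct sum);
  the total space is the disjoint union of the fibres. A local trivialisation over an open set \<open>U\<close> is
  given by the corresponding local frame \<open>F\<close>, a finite set of local sections whose values at each point
  of \<open>U\<close> form a basis of the fibre. The smooth structure is the one determined by these trivialisations,
  whose transition functions must be smooth. Rank \<open>0\<close> is allowed.
\<close>

record ('m, 'v) vector_bundle = "'m manifold" +
  fibre :: "'m \<Rightarrow> 'v set"
  frames :: "('m set \<times> ('m \<Rightarrow> 'v) set) set"

text \<open>\<open>coframe F e p\<close> is the element dual to \<open>e\<close> of the dual frame at \<open>p\<close>; like \<^const>\<open>representation\<close>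
  it is \<open>0\<close> outside the fibre.\<close>

definition coframe :: "('m \<Rightarrow> 'v::real_vector) set \<Rightarrow> ('m \<Rightarrow> 'v) \<Rightarrow> 'm \<Rightarrow> 'v \<Rightarrow> real" where
  "coframe F e p v = representation ((\<lambda>s. s p) ` F) v (e p)"

definition smooth_vector_bundle ::
  "('m::{t2_space, second_countable_topology}, 'v::real_vector, 'z) vector_bundle_scheme \<Rightarrow> bool" where
  "smooth_vector_bundle A \<longleftrightarrow>
     smooth_manifold A \<and>
     (\<forall>p. subspace (fibre A p)) \<and>
     (\<Union>(fst ` frames A) = UNIV) \<and>
     (\<forall>(U, F)\<in>frames A. open U \<and> finite F \<and>
        (\<forall>p\<in>U. inj_on (\<lambda>e. e p) F \<and> independent ((\<lambda>e. e p) ` F) \<and> span ((\<lambda>e. e p) ` F) = fibre A p)) \<and>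
     (\<forall>(U, F)\<in>frames A. \<forall>(V, G)\<in>frames A. \<forall>e\<in>F. \<forall>g\<in>G.
        smooth_fun_on A (U \<inter> V) (\<lambda>p. coframe G g p (e p)))"

text \<open>\<open>\<Gamma>(A)\<close>.\<close>

definition sections ::
  "('m::{t2_space, second_countable_topology}, 'v::real_vector, 'z) vector_bundle_scheme \<Rightarrow> ('m \<Rightarrow> 'v) set" where
  "sections A =
     {x. (\<forall>p. x p \<in> fibre A p) \<and>
         (\<forall>(U, F)\<in>frames A. \<forall>e\<in>F. smooth_fun_on A U (\<lambda>p. coframe F e p (x p)))}"

text \<open>The fibre of \<open>A\<^sup>*\<close>. A linear functional on a fibre is represented by its extension by \<open>0\<close>,
  so that equality of functionals is equality of functions.\<close>

definition dual_fibre ::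
  "('m, 'v::real_vector, 'z) vector_bundle_scheme \<Rightarrow> 'm \<Rightarrow> ('v \<Rightarrow> real) set" where
  "dual_fibre A p =
     {\<xi>. (\<forall>v\<in>fibre A p. \<forall>w\<in>fibre A p. \<xi> (v + w) = \<xi> v + \<xi> w) \<and>
         (\<forall>v\<in>fibre A p. \<forall>c. \<xi> (c *\<^sub>R v) = c * \<xi> v) \<and>
         (\<forall>v. v \<notin> fibre A p \<longrightarrow> \<xi> v = 0)}"

text \<open>\<open>\<Gamma>(A\<^sup>*)\<close>; smoothness refers to the dual frames.\<close>

definition dual_sections ::
  "('m::{t2_space, second_countable_topology}, 'v::real_vector, 'z) vector_bundle_scheme
     \<Rightarrow> ('m \<Rightarrow> 'v \<Rightarrow> real) set" where
  "dual_sections A =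
     {\<alpha>. (\<forall>p. \<alpha> p \<in> dual_fibre A p) \<and>
         (\<forall>(U, F)\<in>frames A. \<forall>e\<in>F. smooth_fun_on A U (\<lambda>p. \<alpha> p (e p)))}"

definition pairing :: "('m \<Rightarrow> 'v \<Rightarrow> real) \<Rightarrow> ('m \<Rightarrow> 'v) \<Rightarrow> 'm \<Rightarrow> real" where
  "pairing \<alpha> x = (\<lambda>p. \<alpha> p (x p))"

text \<open>\<open>Sym\<^sup>2(A)\<close>: the fibre of \<open>A \<otimes> A\<close> at \<open>p\<close> is the space of bilinear forms on the dual fibre.
  The values of \<open>H p\<close> on arguments outside the dual fibre are irrelevant.\<close>

definition Sym2 ::
  "('m::{t2_space, second_countable_topology}, 'v::real_vector, 'z) vector_bundle_scheme
     \<Rightarrow> ('m \<Rightarrow> ('v \<Rightarrow> real) \<Rightarrow> ('v \<Rightarrow> real) \<Rightarrow> real) set" where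
  "Sym2 A =
     {H. (\<forall>p. \<forall>\<xi>\<in>dual_fibre A p. \<forall>\<eta>\<in>dual_fibre A p. H p \<xi> \<eta> = H p \<eta> \<xi>) \<and>
         (\<forall>p. \<forall>\<xi>\<in>dual_fibre A p. \<forall>\<eta>\<in>dual_fibre A p. \<forall>\<zeta>\<in>dual_fibre A p.
            H p (\<lambda>v. \<xi> v + \<eta> v) \<zeta> = H p \<xi> \<zeta> + H p \<eta> \<zeta>) \<and>
         (\<forall>p. \<forall>\<xi>\<in>dual_fibre A p. \<forall>\<zeta>\<in>dual_fibre A p. \<forall>c. H p (\<lambda>v. c * \<xi> v) \<zeta> = c * H p \<xi> \<zeta>) \<and>
         (\<forall>(U, F)\<in>frames A. \<forall>e\<in>F. \<forall>g\<in>F. smooth_fun_on A U (\<lambda>p. H p (coframe F e p) (coframe F g p)))}"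

text \<open>\<open>Sym\<^sup>2(A\<^sup>*)\<close>: symmetric bilinear forms on the fibres; values outside the fibres are irrelevant.\<close>

definition dual_Sym2 ::
  "('m::{t2_space, second_countable_topology}, 'v::real_vector, 'z) vector_bundle_scheme
     \<Rightarrow> ('m \<Rightarrow> 'v \<Rightarrow> 'v \<Rightarrow> real) set" where
  "dual_Sym2 A =
     {B. (\<forall>p. \<forall>v\<in>fibre A p. \<forall>w\<in>fibre A p. B p v w = B p w v) \<and>
         (\<forall>p. \<forall>u\<in>fibre A p. \<forall>v\<in>fibre A p. \<forall>w\<in>fibre A p. B p (u + v) w = B p u w + B p v w) \<and>
         (\<forall>p. \<forall>v\<in>fibre A p. \<forall>w\<in>fibre A p. \<forall>c. B p (c *\<^sub>R v) w = c * B p v w) \<and>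
         (\<forall>(U, F)\<in>frames A. \<forall>e\<in>F. \<forall>g\<in>F. smooth_fun_on A U (\<lambda>p. B p (e p) (g p)))}"

text \<open>Values on sections.\<close>

definition eval2 :: "('m \<Rightarrow> 'a \<Rightarrow> 'a \<Rightarrow> real) \<Rightarrow> ('m \<Rightarrow> 'a) \<Rightarrow> ('m \<Rightarrow> 'a) \<Rightarrow> 'm \<Rightarrow> real" where
  "eval2 T s t = (\<lambda>p. T p (s p) (t p))"

text \<open>\<open>H\<^sup>\<sharp> : A\<^sup>* \<rightarrow> A\<close>, on fibres and on sections.\<close>

definition sharp_at ::
  "('m, 'v::real_vector, 'z) vector_bundle_scheme \<Rightarrow> ('m \<Rightarrow> ('v \<Rightarrow> real) \<Rightarrow> ('v \<Rightarrow> real) \<Rightarrow> real)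
     \<Rightarrow> 'm \<Rightarrow> ('v \<Rightarrow> real) \<Rightarrow> 'v" where
  "sharp_at A H p \<xi> = (THE v. v \<in> fibre A p \<and> (\<forall>\<eta>\<in>dual_fibre A p. \<eta> v = H p \<xi> \<eta>))"

definition sharp ::
  "('m, 'v::real_vector, 'z) vector_bundle_scheme \<Rightarrow> ('m \<Rightarrow> ('v \<Rightarrow> real) \<Rightarrow> ('v \<Rightarrow> real) \<Rightarrow> real)
     \<Rightarrow> ('m \<Rightarrow> 'v \<Rightarrow> real) \<Rightarrow> 'm \<Rightarrow> 'v" where
  "sharp A H \<alpha> = (\<lambda>p. sharp_at A H p (\<alpha> p))"

text \<open>\<open>\<BB>\<^sup>\<natural> : A \<rightarrow> A\<^sup>*\<close>, on fibres and on sections.\<close>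

definition natural_at ::
  "('m, 'v::real_vector, 'z) vector_bundle_scheme \<Rightarrow> ('m \<Rightarrow> 'v \<Rightarrow> 'v \<Rightarrow> real) \<Rightarrow> 'm \<Rightarrow> 'v \<Rightarrow> 'v \<Rightarrow> real" where
  "natural_at A B p v = (\<lambda>w. if w \<in> fibre A p then B p v w else 0)"

definition natural ::
  "('m, 'v::real_vector, 'z) vector_bundle_scheme \<Rightarrow> ('m \<Rightarrow> 'v \<Rightarrow> 'v \<Rightarrow> real)
     \<Rightarrow> ('m \<Rightarrow> 'v) \<Rightarrow> 'm \<Rightarrow> 'v \<Rightarrow> real" where
  "natural A B x = (\<lambda>p. natural_at A B p (x p))"


section \<open>Left-symmetric algebroids\<close>

record ('m, 'v) algebroid = "('m, 'v) vector_bundle" +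
  lsprod :: "('m \<Rightarrow> 'v) \<Rightarrow> ('m \<Rightarrow> 'v) \<Rightarrow> 'm \<Rightarrow> 'v"  (infixl "\<cdot>\<index>" 70)
  anchor :: "'m \<Rightarrow> 'v \<Rightarrow> ('m \<Rightarrow> real) \<Rightarrow> real"

text \<open>A smooth bundle map \<open>A \<rightarrow> TM\<close>: fibrewise linear, and smooth in every local trivialisation of \<open>A\<close>.\<close>

definition smooth_anchor ::
  "('m::{t2_space, second_countable_topology}, 'v::real_vector, 'z) algebroid_scheme \<Rightarrow> bool" where
  "smooth_anchor A \<longleftrightarrow>
     (\<forall>p. \<forall>v\<in>fibre A p. anchor A p v \<in> tangent_space A p) \<and>
     (\<forall>p. \<forall>v\<in>fibre A p. \<forall>w\<in>fibre A p. \<forall>f\<in>Cinf A. anchor A p (v + w) f = anchor A p v f + anchor A p w f) \<and>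
     (\<forall>p. \<forall>v\<in>fibre A p. \<forall>c. \<forall>f\<in>Cinf A. anchor A p (c *\<^sub>R v) f = c * anchor A p v f) \<and>
     (\<forall>(U, F)\<in>frames A. \<forall>e\<in>F. smooth_vector_field_on A U (\<lambda>p. anchor A p (e p)))"

text \<open>\<open>a\<^sub>A(x)(f)\<close> for a section \<open>x\<close>.\<close>

definition act ::
  "('m, 'v, 'z) algebroid_scheme \<Rightarrow> ('m \<Rightarrow> 'v) \<Rightarrow> ('m \<Rightarrow> real) \<Rightarrow> 'm \<Rightarrow> real" where
  "act A x f = (\<lambda>p. anchor A p (x p) f)"

definition left_symmetric_algebroid ::
  "('m::{t2_space, second_countable_topology}, 'v::real_vector, 'z) algebroid_scheme \<Rightarrow> bool" where
  "left_symmetric_algebroid A \<longleftrightarrow>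
     smooth_vector_bundle A \<and>
     smooth_anchor A \<and>
     (\<forall>x\<in>sections A. \<forall>y\<in>sections A. x \<cdot>\<^bsub>A\<^esub> y \<in> sections A) \<and>
     (\<forall>x\<in>sections A. \<forall>y\<in>sections A. \<forall>z\<in>sections A.
        (\<lambda>p. x p + y p) \<cdot>\<^bsub>A\<^esub> z = (\<lambda>p. (x \<cdot>\<^bsub>A\<^esub> z) p + (y \<cdot>\<^bsub>A\<^esub> z) p) \<and>
        z \<cdot>\<^bsub>A\<^esub> (\<lambda>p. x p + y p) = (\<lambda>p. (z \<cdot>\<^bsub>A\<^esub> x) p + (z \<cdot>\<^bsub>A\<^esub> y) p)) \<and>
     (\<forall>x\<in>sections A. \<forall>y\<in>sections A. \<forall>c::real.
        (\<lambda>p. c *\<^sub>R x p) \<cdot>\<^bsub>A\<^esub> y = (\<lambda>p. c *\<^sub>R (x \<cdot>\<^bsub>A\<^esub> y) p) \<and>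
        x \<cdot>\<^bsub>A\<^esub> (\<lambda>p. c *\<^sub>R y p) = (\<lambda>p. c *\<^sub>R (x \<cdot>\<^bsub>A\<^esub> y) p)) \<and>
     (\<forall>x\<in>sections A. \<forall>y\<in>sections A. \<forall>z\<in>sections A. \<forall>p.
        (x \<cdot>\<^bsub>A\<^esub> (y \<cdot>\<^bsub>A\<^esub> z)) p - ((x \<cdot>\<^bsub>A\<^esub> y) \<cdot>\<^bsub>A\<^esub> z) p =
        (y \<cdot>\<^bsub>A\<^esub> (x \<cdot>\<^bsub>A\<^esub> z)) p - ((y \<cdot>\<^bsub>A\<^esub> x) \<cdot>\<^bsub>A\<^esub> z) p) \<and>
     (\<forall>x\<in>sections A. \<forall>y\<in>sections A. \<forall>f\<in>Cinf A.
        x \<cdot>\<^bsub>A\<^esub> (\<lambda>p. f p *\<^sub>R y p) = (\<lambda>p. f p *\<^sub>R (x \<cdot>\<^bsub>A\<^esub> y) p + act A x f p *\<^sub>R y p) \<and>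
        (\<lambda>p. f p *\<^sub>R x p) \<cdot>\<^bsub>A\<^esub> y = (\<lambda>p. f p *\<^sub>R (x \<cdot>\<^bsub>A\<^esub> y) p))"

definition commutator ::
  "('m, 'v::real_vector, 'z) algebroid_scheme \<Rightarrow> ('m \<Rightarrow> 'v) \<Rightarrow> ('m \<Rightarrow> 'v) \<Rightarrow> 'm \<Rightarrow> 'v" where
  "commutator A x y = (\<lambda>p. (x \<cdot>\<^bsub>A\<^esub> y) p - (y \<cdot>\<^bsub>A\<^esub> x) p)"


section \<open>Koszul-Vinberg structures and cocycles\<close>

text \<open>\<open>\<lbrakk>H, H\<rbrakk>\<^sub>A\<close>.\<close>

definition KV_bracket ::
  "('m, 'v::real_vector, 'z) algebroid_scheme \<Rightarrow> ('m \<Rightarrow> ('v \<Rightarrow> real) \<Rightarrow> ('v \<Rightarrow> real) \<Rightarrow> real)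
     \<Rightarrow> ('m \<Rightarrow> 'v \<Rightarrow> real) \<Rightarrow> ('m \<Rightarrow> 'v \<Rightarrow> real) \<Rightarrow> ('m \<Rightarrow> 'v \<Rightarrow> real) \<Rightarrow> 'm \<Rightarrow> real" where
  "KV_bracket A H \<alpha>1 \<alpha>2 \<alpha>3 = (\<lambda>p.
       act A (sharp A H \<alpha>1) (pairing \<alpha>3 (sharp A H \<alpha>2)) p
     - act A (sharp A H \<alpha>2) (pairing \<alpha>3 (sharp A H \<alpha>1)) p
     + pairing \<alpha>1 (sharp A H \<alpha>2 \<cdot>\<^bsub>A\<^esub> sharp A H \<alpha>3) p
     - pairing \<alpha>2 (sharp A H \<alpha>1 \<cdot>\<^bsub>A\<^esub> sharp A H \<alpha>3) p
     - pairing \<alpha>3 (commutator A (sharp A H \<alpha>1) (sharp A H \<alpha>2)) p)"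

definition Koszul_Vinberg_structure ::
  "('m::{t2_space, second_countable_topology}, 'v::real_vector, 'z) algebroid_scheme
     \<Rightarrow> ('m \<Rightarrow> ('v \<Rightarrow> real) \<Rightarrow> ('v \<Rightarrow> real) \<Rightarrow> real) \<Rightarrow> bool" where
  "Koszul_Vinberg_structure A H \<longleftrightarrow>
     H \<in> Sym2 A \<and>
     (\<forall>\<alpha>1\<in>dual_sections A. \<forall>\<alpha>2\<in>dual_sections A. \<forall>\<alpha>3\<in>dual_sections A.
        KV_bracket A H \<alpha>1 \<alpha>2 \<alpha>3 = (\<lambda>p. 0))"

definition coboundary ::
  "('m, 'v::real_vector, 'z) algebroid_scheme \<Rightarrow> ('m \<Rightarrow> 'v \<Rightarrow> 'v \<Rightarrow> real)
     \<Rightarrow> ('m \<Rightarrow> 'v) \<Rightarrow> ('m \<Rightarrow> 'v) \<Rightarrow> ('m \<Rightarrow> 'v) \<Rightarrow> 'm \<Rightarrow> real" where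
  "coboundary A B x y z = (\<lambda>p.
       act A x (eval2 B y z) p
     - act A y (eval2 B x z) p
     - eval2 B y (x \<cdot>\<^bsub>A\<^esub> z) p
     + eval2 B x (y \<cdot>\<^bsub>A\<^esub> z) p
     - eval2 B (commutator A x y) z p)"

definition two_cocycle ::
  "('m::{t2_space, second_countable_topology}, 'v::real_vector, 'z) algebroid_scheme
     \<Rightarrow> ('m \<Rightarrow> 'v \<Rightarrow> 'v \<Rightarrow> real) \<Rightarrow> bool" where
  "two_cocycle A B \<longleftrightarrow>
     B \<in> dual_Sym2 A \<and>
     (\<forall>x\<in>sections A. \<forall>y\<in>sections A. \<forall>z\<in>sections A. coboundary A B x y z = (\<lambda>p. 0))"

text \<open>\<open>\<BB>\<^sub>N(x, y) = \<BB>(N(x), y)\<close> with \<open>N = H\<^sup>\<sharp> \<circ> \<BB>\<^sup>\<natural>\<close>.\<close>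

definition Nmap_at ::
  "('m, 'v::real_vector, 'z) vector_bundle_scheme \<Rightarrow> ('m \<Rightarrow> ('v \<Rightarrow> real) \<Rightarrow> ('v \<Rightarrow> real) \<Rightarrow> real)
     \<Rightarrow> ('m \<Rightarrow> 'v \<Rightarrow> 'v \<Rightarrow> real) \<Rightarrow> 'm \<Rightarrow> 'v \<Rightarrow> 'v" where
  "Nmap_at A H B p v = sharp_at A H p (natural_at A B p v)"

definition twist ::
  "('m, 'v::real_vector, 'z) vector_bundle_scheme \<Rightarrow> ('m \<Rightarrow> ('v \<Rightarrow> real) \<Rightarrow> ('v \<Rightarrow> real) \<Rightarrow> real)
     \<Rightarrow> ('m \<Rightarrow> 'v \<Rightarrow> 'v \<Rightarrow> real) \<Rightarrow> 'm \<Rightarrow> 'v \<Rightarrow> 'v \<Rightarrow> real" where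
  "twist A H B = (\<lambda>p v w. B p (Nmap_at A H B p v) w)"

definition KV_Omega_structure ::
  "('m::{t2_space, second_countable_topology}, 'v::real_vector, 'z) algebroid_scheme
     \<Rightarrow> ('m \<Rightarrow> ('v \<Rightarrow> real) \<Rightarrow> ('v \<Rightarrow> real) \<Rightarrow> real) \<Rightarrow> ('m \<Rightarrow> 'v \<Rightarrow> 'v \<Rightarrow> real) \<Rightarrow> bool" where
  "KV_Omega_structure A H B \<longleftrightarrow>
     Koszul_Vinberg_structure A H \<and> two_cocycle A B \<and> two_cocycle A (twist A H B)"


section \<open>Complementary symmetric 2-tensors\<close>

text \<open>
  The sections \<open>\<L>\<^sub>x \<alpha>\<close>, \<open>R\<^sub>x \<alpha>\<close>, \<open>d\<^sub>A f\<close> and \<open>\<alpha> \<cdot> \<beta>\<close> of \<open>A\<^sup>*\<close> are defined by their pairings with arbitrary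
  sections \<open>y\<close> of \<open>A\<close>. Accordingly they are represented by the function that sends \<open>y\<close> to the pairing,
  i.e. \<open>\<Gamma>(A\<^sup>*)\<close> is identified here with the \<open>C\<^sup>\<infinity>(M)\<close>-linear maps \<open>\<Gamma>(A) \<rightarrow> C\<^sup>\<infinity>(M)\<close>.
\<close>

definition Lie_derivative ::
  "('m, 'v::real_vector, 'z) algebroid_scheme \<Rightarrow> ('m \<Rightarrow> 'v) \<Rightarrow> ('m \<Rightarrow> 'v \<Rightarrow> real)
     \<Rightarrow> ('m \<Rightarrow> 'v) \<Rightarrow> 'm \<Rightarrow> real" where
  "Lie_derivative A x \<alpha> = (\<lambda>y p. act A x (pairing \<alpha> y) p - pairing \<alpha> (commutator A x y) p)"

definition dual_right_mult ::
  "('m, 'v::real_vector, 'z) algebroid_scheme \<Rightarrow> ('m \<Rightarrow> 'v) \<Rightarrow> ('m \<Rightarrow> 'v \<Rightarrow> real)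
     \<Rightarrow> ('m \<Rightarrow> 'v) \<Rightarrow> 'm \<Rightarrow> real" where
  "dual_right_mult A x \<alpha> = (\<lambda>y p. - pairing \<alpha> (y \<cdot>\<^bsub>A\<^esub> x) p)"

definition algebroid_differential ::
  "('m, 'v::real_vector, 'z) algebroid_scheme \<Rightarrow> ('m \<Rightarrow> real) \<Rightarrow> ('m \<Rightarrow> 'v) \<Rightarrow> 'm \<Rightarrow> real" where
  "algebroid_differential A f = (\<lambda>y. act A y f)"

definition dual_product ::
  "('m, 'v::real_vector, 'z) algebroid_scheme \<Rightarrow> ('m \<Rightarrow> ('v \<Rightarrow> real) \<Rightarrow> ('v \<Rightarrow> real) \<Rightarrow> real)
     \<Rightarrow> ('m \<Rightarrow> 'v \<Rightarrow> real) \<Rightarrow> ('m \<Rightarrow> 'v \<Rightarrow> real) \<Rightarrow> ('m \<Rightarrow> 'v) \<Rightarrow> 'm \<Rightarrow> real" where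
  "dual_product A H \<alpha> \<beta> = (\<lambda>y p.
       Lie_derivative A (sharp A H \<alpha>) \<beta> y p
     - dual_right_mult A (sharp A H \<beta>) \<alpha> y p
     - algebroid_differential A (eval2 H \<alpha> \<beta>) y p)"

text \<open>\<open>\<lbrakk>\<BB>, \<BB>\<rbrakk>\<close> for the left-symmetric algebroid \<open>A\<^sup>*\<close>, whose anchor is \<open>a\<^sub>A \<circ> H\<^sup>\<sharp>\<close>.\<close>

definition dual_KV_bracket ::
  "('m, 'v::real_vector, 'z) algebroid_scheme \<Rightarrow> ('m \<Rightarrow> ('v \<Rightarrow> real) \<Rightarrow> ('v \<Rightarrow> real) \<Rightarrow> real)
     \<Rightarrow> ('m \<Rightarrow> 'v \<Rightarrow> 'v \<Rightarrow> real) \<Rightarrow> ('m \<Rightarrow> 'v) \<Rightarrow> ('m \<Rightarrow> 'v) \<Rightarrow> ('m \<Rightarrow> 'v) \<Rightarrow> 'm \<Rightarrow> real" where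
  "dual_KV_bracket A H B x1 x2 x3 = (\<lambda>p.
       act A (sharp A H (natural A B x1)) (pairing (natural A B x2) x3) p
     - act A (sharp A H (natural A B x2)) (pairing (natural A B x1) x3) p
     + dual_product A H (natural A B x2) (natural A B x3) x1 p
     - dual_product A H (natural A B x1) (natural A B x3) x2 p
     - (dual_product A H (natural A B x1) (natural A B x2) x3 p
        - dual_product A H (natural A B x2) (natural A B x1) x3 p))"

definition complementary_symmetric_2_tensor ::
  "('m::{t2_space, second_countable_topology}, 'v::real_vector, 'z) algebroid_scheme
     \<Rightarrow> ('m \<Rightarrow> ('v \<Rightarrow> real) \<Rightarrow> ('v \<Rightarrow> real) \<Rightarrow> real) \<Rightarrow> ('m \<Rightarrow> 'v \<Rightarrow> 'v \<Rightarrow> real) \<Rightarrow> bool" where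
  "complementary_symmetric_2_tensor A H B \<longleftrightarrow>
     B \<in> dual_Sym2 A \<and>
     (\<forall>x1\<in>sections A. \<forall>x2\<in>sections A. \<forall>x3\<in>sections A. dual_KV_bracket A H B x1 x2 x3 = (\<lambda>p. 0))"

end

theory Submission
  imports Defs
begin

text \<open>
  Put \<open>N = H\<^sup>\<sharp> \<circ> \<BB>\<^sup>\<natural>\<close>. Since \<open>\<BB>(N x, y) = H(\<BB>\<^sup>\<natural> x, \<BB>\<^sup>\<natural> y)\<close> is symmetric, expanding the definitions gives,
  for every symmetric \<open>\<BB>\<close>, the identity
  \<open>\<lbrakk>\<BB>, \<BB>\<rbrakk>(x, y, z) + \<delta>\<BB>(N x, y, z) + \<delta>\<BB>(x, N y, z) + \<delta>\<BB>(x, y, N z) = \<delta>(\<BB>\<^sub>N)(x, y, z)\<close>,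
  and the last three terms on the left vanish when \<open>\<BB>\<close> is a cocycle.
  What remains is that \<open>N\<close> preserves smooth sections and that \<open>\<BB>\<^sub>N\<close> is a smooth symmetric form; in a
  local frame both have coefficients that are sums of products of those of \<open>H\<close>, \<open>\<BB>\<close> and the section.
\<close>

section \<open>Sums and products of smooth functions\<close>

lemma continuous_map_Euclidean_space_update:
  assumes x: "x \<in> topspace (Euclidean_space n)" and i: "i < n"
  shows "continuous_map euclideanreal (Euclidean_space n) (\<lambda>t. x(i := t))"
proof -
  have "continuous_map euclideanreal euclideanreal (\<lambda>t. (x(i := t)) j)" for j
    by (cases "j = i") auto
  moreover have "(x(i := t)) j = 0" if "j \<ge> n" for j t
    using x i that by (auto simp: topspace_Euclidean_space)
  ultimately show ?thesis
    unfolding Euclidean_space_def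
    by (auto simp: continuous_map_in_subtopology continuous_map_componentwise_UNIV image_subset_iff)
qed

text \<open>Partial derivatives are one-variable derivatives along the line
  \<open>t \<mapsto> x(i := t)\<close>. This line is continuous into the model space because only a
  coordinate below \<open>n\<close> changes, so the preimage of \<open>S\<close> is an open set of
  parameters around \<open>x i\<close>.\<close>

lemma eventually_update_mem:
  assumes S: "openin (Euclidean_space n) S" and x: "x \<in> S" and i: "i < n"
  shows "\<forall>\<^sub>F t in nhds (x i). x(i := t) \<in> S"
proof -
  have "x \<in> topspace (Euclidean_space n)"
    using S x openin_subset by blast
  then have "openin euclideanreal {t \<in> topspace euclideanreal. x(i := t) \<in> S}"
    using openin_continuous_map_preimage [OF continuous_map_Euclidean_space_update [OF _ i] S] by blast
  then have "open {t. x(i := t) \<in> S}" by simp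
  then show ?thesis
    using x by (auto simp: eventually_nhds intro!: exI [of _ "{t. x(i := t) \<in> S}"])
qed

lemma topspace_open_Euclidean:
  "openin (Euclidean_space n) S \<Longrightarrow> topspace (subtopology (Euclidean_space n) S) = S"
  by (intro topspace_subtopology_subset openin_subset)

text \<open>A derivative at a point also sees nearby values, and values off \<open>S\<close> are
  arbitrary. Openness of \<open>S\<close> makes \<open>f\<close> and \<open>g\<close> agree along
  each coordinate line near the point, so their partial derivatives agree on \<open>S\<close> and
  the induction continues with those.\<close>

lemma Ck_on_cong:
  assumes S: "openin (Euclidean_space n) S"
  shows "\<lbrakk>\<And>x. x \<in> S \<Longrightarrow> f x = g x; Ck_on n k S f\<rbrakk> \<Longrightarrow> Ck_on n k S g"
proof (induction k arbitrary: f g)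
  case 0
  then show ?case
    using continuous_map_eq [of "subtopology (Euclidean_space n) S" _ f g]
      topspace_open_Euclidean [OF S] by simp
next
  case (Suc k)
  have ev: "\<forall>\<^sub>F t in nhds (x i). f (x(i := t)) = g (x(i := t))" if "x \<in> S" "i < n" for x i
    using eventually_update_mem [OF S that] by eventually_elim (rule Suc.prems(1))
  have "(\<lambda>t. g (x(i := t))) differentiable at (x i)" if "x \<in> S" "i < n" for x i
  proof -
    have "(\<lambda>t. f (x(i := t))) differentiable at (x i)" using Suc.prems(2) that by simp
    then show ?thesis
      using DERIV_cong_ev [OF refl ev [OF that] refl] by (auto simp: real_differentiable_def)
  qed
  moreover have "Ck_on n k S (partial_deriv i g)" if "i < n" for i
  proof (rule Suc.IH)
    show "Ck_on n k S (partial_deriv i f)" using Suc.prems(2) that by simp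
    show "partial_deriv i f x = partial_deriv i g x" if "x \<in> S" for x
      unfolding partial_deriv_def by (rule deriv_cong_ev [OF ev [OF that \<open>i < n\<close>] refl])
  qed
  moreover have "continuous_map (subtopology (Euclidean_space n) S) euclideanreal g"
    using Suc.prems continuous_map_eq [of "subtopology (Euclidean_space n) S" _ f g]
      topspace_open_Euclidean [OF S] by simp
  ultimately show ?case by simp
qed

lemma Ck_on_SucD: "Ck_on n (Suc k) S f \<Longrightarrow> Ck_on n k S f"
  by (induction k arbitrary: f) auto

lemma Ck_on_const: "Ck_on n k S (\<lambda>x. c)"
proof (induction k arbitrary: c)
  case (Suc k)
  have "partial_deriv i (\<lambda>x. c) = (\<lambda>x. 0)" for i
    by (simp add: partial_deriv_def fun_eq_iff)
  with Suc show ?case by simp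
qed simp

lemma Ck_on_SucE:
  assumes "Ck_on n (Suc k) S f" "x \<in> S" "i < n"
  shows "((\<lambda>t. f (x(i := t))) has_real_derivative partial_deriv i f x) (at (x i))"
  using assms unfolding partial_deriv_def by (auto simp: DERIV_deriv_iff_real_differentiable)

text \<open>The sum rule is available at points of \<open>S\<close> only, so the partial derivative
  of the sum is replaced by the sum of partial derivatives through
  \<open>Ck_on_cong\<close>.\<close>

lemma Ck_on_add:
  assumes S: "openin (Euclidean_space n) S"
  shows "\<lbrakk>Ck_on n k S f; Ck_on n k S g\<rbrakk> \<Longrightarrow> Ck_on n k S (\<lambda>x. f x + g x)"
proof (induction k arbitrary: f g)
  case 0
  then show ?case by (auto intro: continuous_map_add)
next
  case (Suc k)
  have D: "((\<lambda>t. f (x(i := t)) + g (x(i := t))) has_real_derivative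
      partial_deriv i f x + partial_deriv i g x) (at (x i))" if "x \<in> S" "i < n" for x i
    by (intro DERIV_add Ck_on_SucE [OF Suc.prems(1) that] Ck_on_SucE [OF Suc.prems(2) that])
  have "Ck_on n k S (partial_deriv i (\<lambda>x. f x + g x))" if "i < n" for i
  proof (rule Ck_on_cong [OF S])
    show "Ck_on n k S (\<lambda>x. partial_deriv i f x + partial_deriv i g x)"
      using Suc that by auto
    show "partial_deriv i f x + partial_deriv i g x = partial_deriv i (\<lambda>x. f x + g x) x"
      if "x \<in> S" for x
      unfolding partial_deriv_def [of i "\<lambda>x. f x + g x"]
      using DERIV_imp_deriv [OF D [OF that \<open>i < n\<close>]] by simp
  qed
  moreover have "(\<lambda>t. f (x(i := t)) + g (x(i := t))) differentiable at (x i)"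
    if "x \<in> S" "i < n" for x i
    using D [OF that] real_differentiable_def by blast
  ultimately show ?case using Suc.prems by (auto intro: continuous_map_add)
qed

lemma Ck_on_mult:
  assumes S: "openin (Euclidean_space n) S"
  shows "\<lbrakk>Ck_on n k S f; Ck_on n k S g\<rbrakk> \<Longrightarrow> Ck_on n k S (\<lambda>x. f x * g x)"
proof (induction k arbitrary: f g)
  case 0
  then show ?case by (auto intro: continuous_map_real_mult)
next
  case (Suc k)
  have D: "((\<lambda>t. f (x(i := t)) * g (x(i := t))) has_real_derivative
      partial_deriv i f x * g x + partial_deriv i g x * f x) (at (x i))" if "x \<in> S" "i < n" for x i
    by (rule DERIV_cong [OF DERIV_mult [OF Ck_on_SucE [OF Suc.prems(1) that]
          Ck_on_SucE [OF Suc.prems(2) that]]]) simp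
  have "Ck_on n k S (partial_deriv i (\<lambda>x. f x * g x))" if "i < n" for i
  proof (rule Ck_on_cong [OF S])
    have "Ck_on n k S (partial_deriv i f)" "Ck_on n k S (partial_deriv i g)"
      using Suc.prems that by auto
    \<comment> \<open>The product rule multiplies derivatives of class C^k by the undifferentiated
      functions, which therefore have to be lowered from order \<open>Suc k\<close> to
      \<open>k\<close>.\<close>
    then show "Ck_on n k S (\<lambda>x. partial_deriv i f x * g x + partial_deriv i g x * f x)"
      using Suc.prems by (intro Ck_on_add [OF S] Suc.IH) (blast dest: Ck_on_SucD)+
    show "partial_deriv i f x * g x + partial_deriv i g x * f x = partial_deriv i (\<lambda>x. f x * g x) x"
      if "x \<in> S" for x
      unfolding partial_deriv_def [of i "\<lambda>x. f x * g x"]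
      using DERIV_imp_deriv [OF D [OF that \<open>i < n\<close>]] by simp
  qed
  moreover have "(\<lambda>t. f (x(i := t)) * g (x(i := t))) differentiable at (x i)"
    if "x \<in> S" "i < n" for x i
    using D [OF that] real_differentiable_def by blast
  ultimately show ?case using Suc.prems by (auto intro: continuous_map_real_mult)
qed

section \<open>Transfer to the manifold through charts\<close>

lemma openin_chart_image:
  assumes M: "smooth_manifold M" and c: "(U, \<phi>) \<in> charts M" and W: "open W"
  shows "openin (Euclidean_space (mdim M)) (\<phi> ` (U \<inter> W))"
proof -
  have U: "openin (Euclidean_space (mdim M)) (\<phi> ` U)"
    and h: "homeomorphic_map (top_of_set U) (subtopology (Euclidean_space (mdim M)) (\<phi> ` U)) \<phi>"
    using M c unfolding smooth_manifold_def by auto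
  \<comment> \<open>The chart is a homeomorphism onto its image, hence open onto it; since the image
    is itself open in the model space, relative openness becomes openness there.\<close>
  have "openin (top_of_set U) (U \<inter> W)" using W by (rule openin_open_Int)
  then have "openin (subtopology (Euclidean_space (mdim M)) (\<phi> ` U)) (\<phi> ` (U \<inter> W))"
    using homeomorphic_imp_open_map [OF h] by (auto simp: open_map_def)
  then show ?thesis using openin_trans_full U by blast
qed

lemma chart_inj_on:
  assumes "smooth_manifold M" "(U, \<phi>) \<in> charts M"
  shows "inj_on \<phi> U"
proof -
  have "homeomorphic_map (top_of_set U) (subtopology (Euclidean_space (mdim M)) (\<phi> ` U)) \<phi>"
    using assms unfolding smooth_manifold_def by auto
  then show ?thesis by (auto dest: homeomorphic_imp_injective_map)
qed

text \<open>Coordinate formulas in a frame hold only over the domain of that frame; this lets them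
  decide smoothness there. Injectivity of the chart ensures that \<open>inv_into\<close> returns the
  point of \<open>W\<close> where \<open>f\<close> and \<open>g\<close> agree.\<close>

lemma smooth_fun_on_cong:
  assumes M: "smooth_manifold M" and W: "open W"
    and eq: "\<And>p. p \<in> W \<Longrightarrow> f p = g p" and f: "smooth_fun_on M W f"
  shows "smooth_fun_on M W g"
  unfolding smooth_fun_on_def smooth_Euclidean_def
proof clarify
  fix U \<phi> k assume c: "(U, \<phi>) \<in> charts M"
  show "Ck_on (mdim M) k (\<phi> ` (U \<inter> W)) (\<lambda>x. g (inv_into U \<phi> x))"
  proof (rule Ck_on_cong [OF openin_chart_image [OF M c W]])
    show "Ck_on (mdim M) k (\<phi> ` (U \<inter> W)) (\<lambda>x. f (inv_into U \<phi> x))"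
      using f c unfolding smooth_fun_on_def smooth_Euclidean_def by auto
    show "f (inv_into U \<phi> x) = g (inv_into U \<phi> x)" if "x \<in> \<phi> ` (U \<inter> W)" for x
      using that eq chart_inj_on [OF M c] by (auto simp: inv_into_f_f)
  qed
qed

lemma smooth_fun_on_const: "smooth_fun_on M W (\<lambda>p. c)"
  unfolding smooth_fun_on_def smooth_Euclidean_def by (auto intro: Ck_on_const)

lemma smooth_fun_on_add:
  assumes "smooth_manifold M" "open W" "smooth_fun_on M W f" "smooth_fun_on M W g"
  shows "smooth_fun_on M W (\<lambda>p. f p + g p)"
  using assms unfolding smooth_fun_on_def smooth_Euclidean_def
  by (auto intro!: Ck_on_add [OF openin_chart_image] split: prod.splits)

lemma smooth_fun_on_mult:
  assumes "smooth_manifold M" "open W" "smooth_fun_on M W f" "smooth_fun_on M W g"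
  shows "smooth_fun_on M W (\<lambda>p. f p * g p)"
  using assms unfolding smooth_fun_on_def smooth_Euclidean_def
  by (auto intro!: Ck_on_mult [OF openin_chart_image] split: prod.splits)

lemma smooth_fun_on_sum:
  assumes "smooth_manifold M" "open W" "\<And>i. i \<in> I \<Longrightarrow> smooth_fun_on M W (f i)"
  shows "smooth_fun_on M W (\<lambda>p. \<Sum>i\<in>I. f i p)"
  using assms(3)
proof (induction I rule: infinite_finite_induct)
  case (insert i I)
  then show ?case using smooth_fun_on_add [OF assms(1,2), of "f i"] by auto
qed (simp_all add: smooth_fun_on_const)


section \<open>Fibrewise linear algebra\<close>

lemma smooth_vector_bundleD:
  assumes "smooth_vector_bundle A"
  shows bundle_smooth_manifold: "smooth_manifold A"
    and bundle_subspace: "\<forall>p. subspace (fibre A p)"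
    and bundle_cover: "\<Union>(fst ` frames A) = UNIV"
    and bundle_frames: "\<forall>(U, F)\<in>frames A. open U \<and> finite F \<and>
      (\<forall>p\<in>U. inj_on (\<lambda>e. e p) F \<and> independent ((\<lambda>e. e p) ` F) \<and> span ((\<lambda>e. e p) ` F) = fibre A p)"
  using assms unfolding smooth_vector_bundle_def by - (elim conjE, assumption)+

lemma subspace_fibre: "smooth_vector_bundle A \<Longrightarrow> subspace (fibre A p)"
  by (rule spec [OF bundle_subspace])

lemma frame_exists:
  assumes "smooth_vector_bundle A"
  obtains U F where "(U, F) \<in> frames A" "p \<in> U"
proof -
  have "p \<in> \<Union>(fst ` frames A)" using bundle_cover [OF assms] by simp
  then show ?thesis using that by auto
qed

lemma frame_open: "\<lbrakk>smooth_vector_bundle A; (U, F) \<in> frames A\<rbrakk> \<Longrightarrow> open U"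
  using bspec [OF bundle_frames] by fastforce

lemma frame_finite: "\<lbrakk>smooth_vector_bundle A; (U, F) \<in> frames A\<rbrakk> \<Longrightarrow> finite F"
  using bspec [OF bundle_frames] by fastforce

lemma frame_basis:
  assumes "smooth_vector_bundle A" "(U, F) \<in> frames A" "p \<in> U"
  shows "inj_on (\<lambda>e. e p) F" "independent ((\<lambda>e. e p) ` F)" "span ((\<lambda>e. e p) ` F) = fibre A p"
  using bspec [OF bundle_frames [OF assms(1)] assms(2)] assms(3) by auto

lemma section_in_fibre: "x \<in> sections A \<Longrightarrow> x p \<in> fibre A p"
  by (simp add: sections_def)

lemma section_smooth:
  assumes "x \<in> sections A" "(U, F) \<in> frames A" "e \<in> F"
  shows "smooth_fun_on A U (\<lambda>p. coframe F e p (x p))"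
proof -
  have "\<forall>(U, F)\<in>frames A. \<forall>e\<in>F. smooth_fun_on A U (\<lambda>p. coframe F e p (x p))"
    using assms(1) unfolding sections_def by (elim CollectE conjE)
  with assms(2,3) show ?thesis by auto
qed

lemma frame_in_fibre:
  assumes "smooth_vector_bundle A" "(U, F) \<in> frames A" "p \<in> U" "e \<in> F"
  shows "e p \<in> fibre A p"
  unfolding frame_basis(3) [OF assms(1-3), symmetric] using assms(4) by (intro span_base imageI)

text \<open>Members of the dual fibre are additive on the fibre only, so the induction has to keep
  every partial sum inside the fibre.\<close>

lemma dual_fibre_sum:
  assumes A: "smooth_vector_bundle A" and \<xi>: "\<xi> \<in> dual_fibre A p"
    and v: "\<And>i. i \<in> I \<Longrightarrow> v i \<in> fibre A p"
  shows "\<xi> (\<Sum>i\<in>I. c i *\<^sub>R v i) = (\<Sum>i\<in>I. c i * \<xi> (v i))"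
proof -
  \<comment> \<open>Homogeneity with scalar 0 settles the empty sum and also an infinite
    \<open>I\<close>, where sums default to 0.\<close>
  have "\<xi> (0 *\<^sub>R 0) = 0 * \<xi> 0"
    using \<xi> subspace_0 [OF subspace_fibre [OF A]] unfolding dual_fibre_def by blast
  then have zero: "\<xi> 0 = 0" by simp
  show ?thesis
    using v
  proof (induction I rule: infinite_finite_induct)
    case (insert i I)
    have "c i *\<^sub>R v i \<in> fibre A p" "(\<Sum>i\<in>I. c i *\<^sub>R v i) \<in> fibre A p"
      using subspace_fibre [OF A] insert.prems by (auto intro!: subspace_sum subspace_scale)
    then have "\<xi> (c i *\<^sub>R v i + (\<Sum>i\<in>I. c i *\<^sub>R v i)) = c i * \<xi> (v i) + \<xi> (\<Sum>i\<in>I. c i *\<^sub>R v i)"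
      using \<xi> insert.prems unfolding dual_fibre_def by auto
    then show ?case using insert by simp
  qed (simp_all add: zero)
qed

lemma dual_fibre_0: "(\<lambda>v. 0) \<in> dual_fibre A p"
  by (simp add: dual_fibre_def)

lemma dual_fibre_add:
  "\<lbrakk>\<xi> \<in> dual_fibre A p; \<eta> \<in> dual_fibre A p\<rbrakk> \<Longrightarrow> (\<lambda>v. \<xi> v + \<eta> v) \<in> dual_fibre A p"
  by (auto simp: dual_fibre_def algebra_simps)

lemma dual_fibre_scale: "\<xi> \<in> dual_fibre A p \<Longrightarrow> (\<lambda>v. c * \<xi> v) \<in> dual_fibre A p"
  by (auto simp: dual_fibre_def algebra_simps)

lemma dual_fibre_lincomb:
  "(\<And>i. i \<in> I \<Longrightarrow> \<xi> i \<in> dual_fibre A p) \<Longrightarrow> (\<lambda>v. \<Sum>i\<in>I. c i * \<xi> i v) \<in> dual_fibre A p"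
proof (induction I rule: infinite_finite_induct)
  case (insert i I)
  then show ?case
    using dual_fibre_add [OF dual_fibre_scale [of "\<xi> i" A p "c i"]] by simp
qed (simp_all add: dual_fibre_0)

text \<open>\<open>representation\<close> is linear on the span of the frame values, which is the
  fibre, and vanishes off it; this matches the convention that functionals are extended by
  0.\<close>

lemma coframe_in_dual_fibre:
  assumes "smooth_vector_bundle A" "(U, F) \<in> frames A" "p \<in> U"
  shows "coframe F e p \<in> dual_fibre A p"
  using frame_basis(2,3) [OF assms] unfolding dual_fibre_def coframe_def
  by (auto simp: representation_add representation_scale)
     (simp add: representation_def)

lemma frame_expansion:
  assumes "smooth_vector_bundle A" "(U, F) \<in> frames A" "p \<in> U" and v: "v \<in> fibre A p"
  shows "v = (\<Sum>e\<in>F. coframe F e p v *\<^sub>R e p)"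
proof -
  let ?B = "(\<lambda>e. e p) ` F"
  have "(\<Sum>b\<in>?B. representation ?B v b *\<^sub>R b) = v"
    using frame_basis [OF assms(1-3)] v frame_finite [OF assms(1,2)]
    by (intro sum_representation_eq) auto
  \<comment> \<open>Injectivity of evaluation at \<open>p\<close> turns the sum over basis vectors
    into a sum over frame sections.\<close>
  then show ?thesis
    using frame_basis(1) [OF assms(1-3)] by (simp add: sum.reindex coframe_def)
qed

lemma coframe_frame:
  assumes "smooth_vector_bundle A" "(U, F) \<in> frames A" "p \<in> U" "e \<in> F" "g \<in> F"
  shows "coframe F e p (g p) = (if e = g then 1 else 0)"
  using frame_basis [OF assms(1-3)] assms(4,5)
  by (auto simp: coframe_def representation_basis dest: inj_onD)

text \<open>This is an equality on the whole ambient space: on the fibre, expand \<open>v\<close> in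
  the frame; off the fibre, both sides are 0.\<close>

lemma coframe_expansion:
  assumes "smooth_vector_bundle A" "(U, F) \<in> frames A" "p \<in> U" and \<xi>: "\<xi> \<in> dual_fibre A p"
  shows "\<xi> = (\<lambda>v. \<Sum>e\<in>F. \<xi> (e p) * coframe F e p v)"
proof
  fix v
  show "\<xi> v = (\<Sum>e\<in>F. \<xi> (e p) * coframe F e p v)"
  proof (cases "v \<in> fibre A p")
    case True
    have "\<xi> v = \<xi> (\<Sum>e\<in>F. coframe F e p v *\<^sub>R e p)"
      using frame_expansion [OF assms(1-3) True] by simp
    also have "\<dots> = (\<Sum>e\<in>F. coframe F e p v * \<xi> (e p))"
      by (intro dual_fibre_sum [OF assms(1) \<xi>] frame_in_fibre [OF assms(1-3)])
    finally show ?thesis by (simp add: mult.commute)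
  next
    case False
    then show ?thesis
      using \<xi> coframe_in_dual_fibre [OF assms(1-3)] by (simp add: dual_fibre_def)
  qed
qed

section \<open>Symmetric tensors and the maps between a fibre and its dual\<close>

lemma Sym2_smooth:
  assumes "H \<in> Sym2 A" and F: "(U, F) \<in> frames A" "e \<in> F" "g \<in> F"
  shows "smooth_fun_on A U (\<lambda>p. H p (coframe F e p) (coframe F g p))"
proof -
  have "\<forall>(U, F)\<in>frames A. \<forall>e\<in>F. \<forall>g\<in>F.
      smooth_fun_on A U (\<lambda>p. H p (coframe F e p) (coframe F g p))"
    using assms(1) unfolding Sym2_def by (elim CollectE conjE)
  with F show ?thesis by auto
qed

lemma Sym2_add_left:
  assumes "H \<in> Sym2 A" and "\<xi> \<in> dual_fibre A p" "\<eta> \<in> dual_fibre A p" "\<zeta> \<in> dual_fibre A p"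
  shows "H p (\<lambda>v. \<xi> v + \<eta> v) \<zeta> = H p \<xi> \<zeta> + H p \<eta> \<zeta>"
proof -
  have "\<forall>p. \<forall>\<xi>\<in>dual_fibre A p. \<forall>\<eta>\<in>dual_fibre A p. \<forall>\<zeta>\<in>dual_fibre A p.
      H p (\<lambda>v. \<xi> v + \<eta> v) \<zeta> = H p \<xi> \<zeta> + H p \<eta> \<zeta>"
    using assms(1) unfolding Sym2_def by (elim CollectE conjE)
  with assms(2-) show ?thesis by simp
qed

lemma Sym2_scale_left:
  assumes "H \<in> Sym2 A" and "\<xi> \<in> dual_fibre A p" "\<zeta> \<in> dual_fibre A p"
  shows "H p (\<lambda>v. c * \<xi> v) \<zeta> = c * H p \<xi> \<zeta>"
proof -
  have "\<forall>p. \<forall>\<xi>\<in>dual_fibre A p. \<forall>\<zeta>\<in>dual_fibre A p. \<forall>c.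
      H p (\<lambda>v. c * \<xi> v) \<zeta> = c * H p \<xi> \<zeta>"
    using assms(1) unfolding Sym2_def by (elim CollectE conjE)
  with assms(2-) show ?thesis by simp
qed

lemma Sym2_sum_left:
  assumes H: "H \<in> Sym2 A" and \<zeta>: "\<zeta> \<in> dual_fibre A p"
    and \<xi>: "\<And>i. i \<in> I \<Longrightarrow> \<xi> i \<in> dual_fibre A p"
  shows "H p (\<lambda>v. \<Sum>i\<in>I. c i * \<xi> i v) \<zeta> = (\<Sum>i\<in>I. c i * H p (\<xi> i) \<zeta>)"
proof -
  have zero: "H p (\<lambda>v. 0) \<zeta> = 0"
    using Sym2_scale_left [OF H dual_fibre_0 \<zeta>, of 0] by simp
  show ?thesis
    using \<xi>
  proof (induction I rule: infinite_finite_induct)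
    case (insert i I)
    have i: "\<xi> i \<in> dual_fibre A p" and I: "(\<lambda>v. \<Sum>i\<in>I. c i * \<xi> i v) \<in> dual_fibre A p"
      using insert.prems dual_fibre_lincomb [of I \<xi> A p c] by auto
    have "H p (\<lambda>v. c i * \<xi> i v + (\<Sum>i\<in>I. c i * \<xi> i v)) \<zeta>
        = H p (\<lambda>v. c i * \<xi> i v) \<zeta> + H p (\<lambda>v. \<Sum>i\<in>I. c i * \<xi> i v) \<zeta>"
      by (rule Sym2_add_left [OF H dual_fibre_scale [OF i] I \<zeta>])
    also have "H p (\<lambda>v. c i * \<xi> i v) \<zeta> = c i * H p (\<xi> i) \<zeta>"
      by (rule Sym2_scale_left [OF H i \<zeta>])
    finally show ?case using insert by simp
  qed (simp_all add: zero)
qed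

lemma Sym2_sym:
  assumes "H \<in> Sym2 A" and "\<xi> \<in> dual_fibre A p" "\<eta> \<in> dual_fibre A p"
  shows "H p \<xi> \<eta> = H p \<eta> \<xi>"
proof -
  have "\<forall>p. \<forall>\<xi>\<in>dual_fibre A p. \<forall>\<eta>\<in>dual_fibre A p. H p \<xi> \<eta> = H p \<eta> \<xi>"
    using assms(1) unfolding Sym2_def by (elim CollectE conjE)
  with assms(2-) show ?thesis by blast
qed

lemma Sym2_expansion:
  assumes "smooth_vector_bundle A" "(U, F) \<in> frames A" "p \<in> U" and H: "H \<in> Sym2 A"
    and \<xi>: "\<xi> \<in> dual_fibre A p" and \<zeta>: "\<zeta> \<in> dual_fibre A p"
  shows "H p \<xi> \<zeta> = (\<Sum>e\<in>F. \<xi> (e p) * H p (coframe F e p) \<zeta>)"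
proof -
  have "H p \<xi> \<zeta> = H p (\<lambda>v. \<Sum>e\<in>F. \<xi> (e p) * coframe F e p v) \<zeta>"
    by (rule arg_cong [OF coframe_expansion [OF assms(1-3) \<xi>]])
  also have "\<dots> = (\<Sum>e\<in>F. \<xi> (e p) * H p (coframe F e p) \<zeta>)"
    by (rule Sym2_sum_left [OF H \<zeta> coframe_in_dual_fibre [OF assms(1-3)]])
  finally show ?thesis .
qed

text \<open>The description by \<open>THE\<close> is meaningful because the fibre has finite
  dimension: a frame supplies a vector representing \<open>H p \<xi>\<close>, and its coordinates
  are forced.\<close>

lemma sharp_at_props:
  assumes A: "smooth_vector_bundle A" and H: "H \<in> Sym2 A" and \<xi>: "\<xi> \<in> dual_fibre A p"
  shows sharp_at_in_fibre: "sharp_at A H p \<xi> \<in> fibre A p"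
    and sharp_at_eq: "\<eta> \<in> dual_fibre A p \<Longrightarrow> \<eta> (sharp_at A H p \<xi>) = H p \<xi> \<eta>"
proof -
  obtain U F where F: "(U, F) \<in> frames A" "p \<in> U" using frame_exists [OF A] by blast
  note e = frame_in_fibre [OF A F] and ce = coframe_in_dual_fibre [OF A F]
  let ?P = "\<lambda>v. v \<in> fibre A p \<and> (\<forall>\<eta>\<in>dual_fibre A p. \<eta> v = H p \<xi> \<eta>)"
  \<comment> \<open>Testing the defining property on the dual frame dictates these
    coefficients.\<close>
  let ?v = "\<Sum>e\<in>F. H p \<xi> (coframe F e p) *\<^sub>R e p"
  have "\<eta> ?v = H p \<xi> \<eta>" if \<eta>: "\<eta> \<in> dual_fibre A p" for \<eta>
  proof -
    have "\<eta> ?v = (\<Sum>e\<in>F. \<eta> (e p) * H p (coframe F e p) \<xi>)"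
      using dual_fibre_sum [OF A \<eta>, of F] e Sym2_sym [OF H \<xi> ce] by (simp add: mult.commute)
    also have "\<dots> = H p \<xi> \<eta>"
      using Sym2_expansion [OF A F H \<eta> \<xi>] Sym2_sym [OF H \<xi> \<eta>] by simp
    finally show ?thesis .
  qed
  moreover have "?v \<in> fibre A p"
    using e by (intro subspace_sum subspace_scale subspace_fibre [OF A])
  ultimately have ex: "?P ?v" by blast
  have uniq: "v = ?v" if "?P v" for v
  proof -
    have "coframe F e p v = H p \<xi> (coframe F e p)" for e using that ce by blast
    then show ?thesis using frame_expansion [OF A F, of v] that by simp
  qed
  have P: "?P (sharp_at A H p \<xi>)"
    unfolding sharp_at_def by (rule theI [of ?P, OF ex uniq])
  show "sharp_at A H p \<xi> \<in> fibre A p"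
    and "\<eta> \<in> dual_fibre A p \<Longrightarrow> \<eta> (sharp_at A H p \<xi>) = H p \<xi> \<eta>"
    by (rule conjunct1 [OF P], rule bspec [OF conjunct2 [OF P]])
qed

lemma dual_Sym2_sym:
  assumes "B \<in> dual_Sym2 A" and "v \<in> fibre A p" "w \<in> fibre A p"
  shows "B p v w = B p w v"
proof -
  have "\<forall>p. \<forall>v\<in>fibre A p. \<forall>w\<in>fibre A p. B p v w = B p w v"
    using assms(1) unfolding dual_Sym2_def by (elim CollectE conjE)
  with assms(2-) show ?thesis by blast
qed

lemma dual_Sym2_smooth:
  assumes "B \<in> dual_Sym2 A" and F: "(U, F) \<in> frames A" "e \<in> F" "g \<in> F"
  shows "smooth_fun_on A U (\<lambda>p. B p (e p) (g p))"
proof -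
  have "\<forall>(U, F)\<in>frames A. \<forall>e\<in>F. \<forall>g\<in>F. smooth_fun_on A U (\<lambda>p. B p (e p) (g p))"
    using assms(1) unfolding dual_Sym2_def by (elim CollectE conjE)
  with F show ?thesis by auto
qed

lemma dual_Sym2_add_left:
  assumes "B \<in> dual_Sym2 A" and "u \<in> fibre A p" "v \<in> fibre A p" "w \<in> fibre A p"
  shows "B p (u + v) w = B p u w + B p v w"
proof -
  have "\<forall>p. \<forall>u\<in>fibre A p. \<forall>v\<in>fibre A p. \<forall>w\<in>fibre A p.
      B p (u + v) w = B p u w + B p v w"
    using assms(1) unfolding dual_Sym2_def by (elim CollectE conjE)
  with assms(2-) show ?thesis by simp
qed

lemma dual_Sym2_scale_left:
  assumes "B \<in> dual_Sym2 A" and "v \<in> fibre A p" "w \<in> fibre A p"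
  shows "B p (c *\<^sub>R v) w = c * B p v w"
proof -
  have "\<forall>p. \<forall>v\<in>fibre A p. \<forall>w\<in>fibre A p. \<forall>c. B p (c *\<^sub>R v) w = c * B p v w"
    using assms(1) unfolding dual_Sym2_def by (elim CollectE conjE)
  with assms(2-) show ?thesis by simp
qed

text \<open>\<open>dual_Sym2\<close> postulates linearity in the first slot, whereas here the second
  slot varies; symmetry transports it.\<close>

lemma natural_at_in_dual_fibre:
  assumes A: "smooth_vector_bundle A" and B: "B \<in> dual_Sym2 A" and v: "v \<in> fibre A p"
  shows "natural_at A B p v \<in> dual_fibre A p"
proof -
  note S = subspace_fibre [OF A, of p]
  have "B p v (w + u) = B p v w + B p v u" if w: "w \<in> fibre A p" and u: "u \<in> fibre A p" for w u
  proof -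
    have "B p v (w + u) = B p (w + u) v" by (rule dual_Sym2_sym [OF B v subspace_add [OF S w u]])
    also have "\<dots> = B p w v + B p u v" by (rule dual_Sym2_add_left [OF B w u v])
    finally show ?thesis unfolding dual_Sym2_sym [OF B w v] dual_Sym2_sym [OF B u v] .
  qed
  moreover have "B p v (c *\<^sub>R w) = c * B p v w" if w: "w \<in> fibre A p" for w c
  proof -
    have "B p v (c *\<^sub>R w) = B p (c *\<^sub>R w) v" by (rule dual_Sym2_sym [OF B v subspace_scale [OF S w]])
    also have "\<dots> = c * B p w v" by (rule dual_Sym2_scale_left [OF B w v])
    finally show ?thesis unfolding dual_Sym2_sym [OF B w v] .
  qed
  ultimately show ?thesis
    using subspace_add [OF S] subspace_scale [OF S] by (simp add: dual_fibre_def natural_at_def)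
qed

lemma dual_Sym2_diff_left:
  assumes A: "smooth_vector_bundle A" and B: "B \<in> dual_Sym2 A"
    and "u \<in> fibre A p" "v \<in> fibre A p" "w \<in> fibre A p"
  shows "B p (u - v) w = B p u w - B p v w"
  using dual_Sym2_add_left [OF B subspace_diff [OF subspace_fibre [OF A] assms(3,4)] assms(4,5)]
  by simp


section \<open>The endomorphism \<open>N\<close> and the twisted form\<close>

context
  fixes A :: "('m::{t2_space, second_countable_topology}, 'v::real_vector, 'z) vector_bundle_scheme"
    and H :: "'m \<Rightarrow> ('v \<Rightarrow> real) \<Rightarrow> ('v \<Rightarrow> real) \<Rightarrow> real"
    and B :: "'m \<Rightarrow> 'v \<Rightarrow> 'v \<Rightarrow> real"
  assumes A: "smooth_vector_bundle A" and H: "H \<in> Sym2 A" and B: "B \<in> dual_Sym2 A"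
begin

lemma Nmap_at_in_fibre: "v \<in> fibre A p \<Longrightarrow> Nmap_at A H B p v \<in> fibre A p"
  unfolding Nmap_at_def by (rule sharp_at_in_fibre [OF A H natural_at_in_dual_fibre [OF A B]])

text \<open>By symmetry of \<open>B\<close>, \<open>B(N v, w)\<close> is the functional of
  \<open>w\<close> evaluated at \<open>N v\<close>, to which the defining property of
  \<open>sharp_at\<close> applies. The right-hand side makes the symmetry of the twisted form
  visible.\<close>

lemma twist_eq_Sym2:
  assumes v: "v \<in> fibre A p" and w: "w \<in> fibre A p"
  shows "twist A H B p v w = H p (natural_at A B p v) (natural_at A B p w)"
proof -
  have "twist A H B p v w = natural_at A B p w (Nmap_at A H B p v)"
    using Nmap_at_in_fibre [OF v] dual_Sym2_sym [OF B Nmap_at_in_fibre [OF v] w]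
    unfolding twist_def natural_at_def by (simp only: if_True)
  also have "\<dots> = H p (natural_at A B p v) (natural_at A B p w)"
    unfolding Nmap_at_def
    by (rule sharp_at_eq [OF A H natural_at_in_dual_fibre [OF A B v]
          natural_at_in_dual_fibre [OF A B w]])
  finally show ?thesis .
qed

lemma twist_sym:
  assumes v: "v \<in> fibre A p" and w: "w \<in> fibre A p"
  shows "twist A H B p v w = twist A H B p w v"
  unfolding twist_eq_Sym2 [OF v w] twist_eq_Sym2 [OF w v]
  by (rule Sym2_sym [OF H natural_at_in_dual_fibre [OF A B v] natural_at_in_dual_fibre [OF A B w]])

text \<open>In a frame, \<open>N\<close> is the product of the coefficient matrices of
  \<open>B\<close> and \<open>H\<close>: first compute the components of the functional of
  \<open>v\<close>, then apply \<open>H\<close>.\<close>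

lemma coframe_Nmap_at:
  assumes F: "(U, F) \<in> frames A" "p \<in> U" and v: "v \<in> fibre A p" "f \<in> F"
  shows "coframe F f p (Nmap_at A H B p v) =
    (\<Sum>g\<in>F. (\<Sum>e\<in>F. coframe F e p v * B p (e p) (g p)) * H p (coframe F g p) (coframe F f p))"
proof -
  note n = natural_at_in_dual_fibre [OF A B v(1)] and c = coframe_in_dual_fibre [OF A F]
  have nat: "natural_at A B p v (g p) = (\<Sum>e\<in>F. coframe F e p v * B p (e p) (g p))"
    if g: "g \<in> F" for g
  proof -
    note gp = frame_in_fibre [OF A F g]
    note ng = natural_at_in_dual_fibre [OF A B gp]
    have "natural_at A B p v (g p) = natural_at A B p (g p) v"
      using dual_Sym2_sym [OF B v(1) gp] v(1) gp unfolding natural_at_def by (simp only: if_True)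
    also have "\<dots> = (\<Sum>e\<in>F. natural_at A B p (g p) (e p) * coframe F e p v)"
      by (rule fun_cong [OF coframe_expansion [OF A F ng]])
    also have "\<dots> = (\<Sum>e\<in>F. coframe F e p v * B p (e p) (g p))"
    proof (rule sum.cong [OF refl])
      fix e assume "e \<in> F"
      then have ep: "e p \<in> fibre A p" by (rule frame_in_fibre [OF A F])
      then show "natural_at A B p (g p) (e p) * coframe F e p v = coframe F e p v * B p (e p) (g p)"
        using dual_Sym2_sym [OF B ep gp] by (simp add: natural_at_def)
    qed
    finally show ?thesis .
  qed
  have "coframe F f p (Nmap_at A H B p v) = H p (natural_at A B p v) (coframe F f p)"
    unfolding Nmap_at_def by (rule sharp_at_eq [OF A H n c])
  also have "\<dots> = (\<Sum>g\<in>F. natural_at A B p v (g p) * H p (coframe F g p) (coframe F f p))"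
    by (rule Sym2_expansion [OF A F H n c])
  finally show ?thesis using nat by simp
qed

text \<open>The section is only required over \<open>U\<close>, so that the lemma applies both to
  global sections and to the members of the frame.\<close>

lemma smooth_coframe_Nmap:
  assumes F: "(U, F) \<in> frames A" and f: "f \<in> F"
    and x: "\<And>p. p \<in> U \<Longrightarrow> x p \<in> fibre A p"
    and sm: "\<And>e. e \<in> F \<Longrightarrow> smooth_fun_on A U (\<lambda>p. coframe F e p (x p))"
  shows "smooth_fun_on A U (\<lambda>p. coframe F f p (Nmap_at A H B p (x p)))"
proof -
  note M = bundle_smooth_manifold [OF A] and U = frame_open [OF A F]
  have "smooth_fun_on A U (\<lambda>p. B p (e p) (g p))" if "e \<in> F" "g \<in> F" for e g
    by (rule dual_Sym2_smooth [OF B F that])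
  moreover have "smooth_fun_on A U (\<lambda>p. H p (coframe F g p) (coframe F f p))" if "g \<in> F" for g
    by (rule Sym2_smooth [OF H F that f])
  ultimately have "smooth_fun_on A U (\<lambda>p. \<Sum>g\<in>F.
      (\<Sum>e\<in>F. coframe F e p (x p) * B p (e p) (g p)) * H p (coframe F g p) (coframe F f p))"
    using sm by (intro smooth_fun_on_sum smooth_fun_on_mult M U) auto
  then show ?thesis
    by (rule smooth_fun_on_cong [OF M U, rotated]) (simp add: coframe_Nmap_at [OF F _ x f])
qed

lemma Nmap_in_sections:
  assumes x: "x \<in> sections A"
  shows "(\<lambda>p. Nmap_at A H B p (x p)) \<in> sections A"
proof -
  have "smooth_fun_on A U (\<lambda>p. coframe F f p (Nmap_at A H B p (x p)))"
    if "(U, F) \<in> frames A" "f \<in> F" for U F f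
    using section_in_fibre [OF x] section_smooth [OF x that(1)]
    by (rule smooth_coframe_Nmap [OF that])
  then show ?thesis
    using Nmap_at_in_fibre section_in_fibre [OF x] unfolding sections_def by auto
qed

text \<open>Membership in \<open>dual_Sym2\<close> is part of being a 2-cocycle, so it has to be
  established for the twisted form before any coboundary is considered.\<close>

lemma twist_in_dual_Sym2: "twist A H B \<in> dual_Sym2 A"
proof -
  note M = bundle_smooth_manifold [OF A]
  \<comment> \<open>The second slot is easy, since \<open>N w\<close> determines an element of the
    dual fibre; \<open>twist_sym\<close> later moves linearity to the first slot.\<close>
  have right: "twist A H B p w (u + v) = twist A H B p w u + twist A H B p w v"
    "twist A H B p w (c *\<^sub>R u) = c * twist A H B p w u"
    if "u \<in> fibre A p" "v \<in> fibre A p" "w \<in> fibre A p" for p u v w c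
    using natural_at_in_dual_fibre [OF A B Nmap_at_in_fibre [OF that(3)]] that
      subspace_add [OF subspace_fibre [OF A]] subspace_scale [OF subspace_fibre [OF A]]
    by (auto simp: twist_def natural_at_def dual_fibre_def)
  have smooth: "smooth_fun_on A U (\<lambda>p. twist A H B p (e p) (g p))"
    if F: "(U, F) \<in> frames A" and eg: "e \<in> F" "g \<in> F" for U F e g
  proof -
    note U = frame_open [OF A F]
    \<comment> \<open>A frame member has constant coordinates 0 or 1 in its own frame.\<close>
    have cf: "smooth_fun_on A U (\<lambda>p. coframe F f p (e p))" if "f \<in> F" for f
      by (rule smooth_fun_on_cong [OF M U _ smooth_fun_on_const [of A U "if f = e then 1 else 0"]])
         (simp add: coframe_frame [OF A F _ that eg(1)])
    have N: "smooth_fun_on A U (\<lambda>p. coframe F f p (Nmap_at A H B p (e p)))" if "f \<in> F" for f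
      by (rule smooth_coframe_Nmap [OF F that frame_in_fibre [OF A F _ eg(1)] cf])
    have BF: "smooth_fun_on A U (\<lambda>p. B p (g p) (f p))" if "f \<in> F" for f
      by (rule dual_Sym2_smooth [OF B F eg(2) that])
    have "smooth_fun_on A U (\<lambda>p. \<Sum>f\<in>F. B p (g p) (f p) * coframe F f p (Nmap_at A H B p (e p)))"
      using N BF by (intro smooth_fun_on_sum smooth_fun_on_mult M U)
    then show ?thesis
    proof (rule smooth_fun_on_cong [OF M U, rotated])
      show "(\<Sum>f\<in>F. B p (g p) (f p) * coframe F f p (Nmap_at A H B p (e p)))
          = twist A H B p (e p) (g p)" if p: "p \<in> U" for p
      proof -
        note fp = frame_in_fibre [OF A F p]
        note Ne = Nmap_at_in_fibre [OF fp [OF eg(1)]]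
        have "twist A H B p (e p) (g p) = natural_at A B p (g p) (Nmap_at A H B p (e p))"
          using Ne dual_Sym2_sym [OF B Ne fp [OF eg(2)]]
          unfolding twist_def natural_at_def by (simp only: if_True)
        also have "\<dots> = (\<Sum>f\<in>F. natural_at A B p (g p) (f p) * coframe F f p (Nmap_at A H B p (e p)))"
          by (rule fun_cong [OF coframe_expansion
                [OF A F p natural_at_in_dual_fibre [OF A B fp [OF eg(2)]]]])
        also have "\<dots> = (\<Sum>f\<in>F. B p (g p) (f p) * coframe F f p (Nmap_at A H B p (e p)))"
          using fp by (intro sum.cong) (auto simp: natural_at_def)
        finally show ?thesis by simp
      qed
    qed
  qed
  have "twist A H B p (u + v) w = twist A H B p u w + twist A H B p v w"
    if u: "u \<in> fibre A p" and v: "v \<in> fibre A p" and w: "w \<in> fibre A p" for p u v w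
    using right(1) [OF u v w]
    unfolding twist_sym [OF w subspace_add [OF subspace_fibre [OF A] u v]]
      twist_sym [OF w u] twist_sym [OF w v] .
  moreover have "twist A H B p (c *\<^sub>R u) w = c * twist A H B p u w"
    if u: "u \<in> fibre A p" and w: "w \<in> fibre A p" for p u w c
    using right(2) [OF u u w]
    unfolding twist_sym [OF w subspace_scale [OF subspace_fibre [OF A] u]] twist_sym [OF w u] .
  moreover have "\<forall>(U, F)\<in>frames A. \<forall>e\<in>F. \<forall>g\<in>F.
      smooth_fun_on A U (\<lambda>p. twist A H B p (e p) (g p))"
    using smooth by auto
  ultimately show ?thesis
    unfolding dual_Sym2_def mem_Collect_eq
    by (intro conjI allI ballI twist_sym) (assumption | erule (1) bspec)+
qed

end


section \<open>The key identity\<close>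

text \<open>In the bracket, the anchor terms along \<open>N x\<close> and \<open>N y\<close> add up
  to the negatives of those in the first two coboundaries. The anchor terms along \<open>z\<close>
  cancel because \<open>H\<close> is symmetric on the functionals of \<open>x\<close> and
  \<open>y\<close>. The terms along \<open>x\<close> and \<open>y\<close> combine to those of the
  twisted form, and the remaining products cancel or match after applying symmetry.\<close>

lemma dual_KV_bracket_coboundary:
  fixes A :: "('m::{t2_space, second_countable_topology}, 'v::real_vector, 'z) algebroid_scheme"
  assumes A: "smooth_vector_bundle A"
    and closed: "\<And>x y. x \<in> sections A \<Longrightarrow> y \<in> sections A \<Longrightarrow> x \<cdot>\<^bsub>A\<^esub> y \<in> sections A"
    and H: "H \<in> Sym2 A" and B: "B \<in> dual_Sym2 A"
    and x: "x \<in> sections A" and y: "y \<in> sections A" and z: "z \<in> sections A"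
  defines "N \<equiv> \<lambda>x p. Nmap_at A H B p (x p)"
  shows "dual_KV_bracket A H B x y z p
      + coboundary A B (N x) y z p + coboundary A B x (N y) z p + coboundary A B x y (N z) p
    = coboundary A (twist A H B) x y z p"
proof -
  note fib = section_in_fibre
  have N: "N u \<in> sections A" if "u \<in> sections A" for u
    unfolding N_def by (rule Nmap_in_sections [OF A H B that])
  have sharp: "sharp A H (natural A B u) = N u" for u
    by (simp add: sharp_def natural_def N_def Nmap_at_def)
  \<comment> \<open>This and the symmetry facts below are equations between functions, since
    \<open>act\<close> takes the whole function as its argument.\<close>
  have pair: "pairing (natural A B u) w = eval2 B u w" if "w \<in> sections A" for u w
    using fib [OF that] by (simp add: pairing_def natural_def natural_at_def eval2_def)
  have sym: "eval2 B u w = eval2 B w u" if "u \<in> sections A" "w \<in> sections A" for u w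
    using dual_Sym2_sym [OF B fib fib] that by (auto simp: eval2_def)
  have twist: "eval2 (twist A H B) u w = eval2 B (N u) w" for u w
    by (simp add: eval2_def twist_def N_def)
  have Nsym: "eval2 B (N u) w = eval2 B (N w) u" if "u \<in> sections A" "w \<in> sections A" for u w
    using twist_sym [OF A H B fib fib] that by (auto simp: eval2_def twist_def N_def)
  have HN: "eval2 H (natural A B u) (natural A B w) = eval2 B (N u) w"
    if "u \<in> sections A" "w \<in> sections A" for u w
    using twist_eq_Sym2 [OF A H B fib fib] that
    by (auto simp: eval2_def twist_def N_def natural_def)
  have cfib: "commutator A u w q \<in> fibre A q" if "u \<in> sections A" "w \<in> sections A" for u w q
    unfolding commutator_def
    using that by (intro subspace_diff subspace_fibre [OF A] fib closed)
  have pair_comm: "pairing (natural A B t) (commutator A u w) q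
      = eval2 B (u \<cdot>\<^bsub>A\<^esub> w) t q - eval2 B (w \<cdot>\<^bsub>A\<^esub> u) t q"
    and comm: "eval2 B (commutator A u w) t q = eval2 B (u \<cdot>\<^bsub>A\<^esub> w) t q - eval2 B (w \<cdot>\<^bsub>A\<^esub> u) t q"
    if "t \<in> sections A" "u \<in> sections A" "w \<in> sections A" for t u w q
  proof -
    show *: "eval2 B (commutator A u w) t q = eval2 B (u \<cdot>\<^bsub>A\<^esub> w) t q - eval2 B (w \<cdot>\<^bsub>A\<^esub> u) t q"
      unfolding eval2_def commutator_def
      using that by (intro dual_Sym2_diff_left [OF A B] fib closed)
    have "pairing (natural A B t) (commutator A u w) q = B q (t q) (commutator A u w q)"
      using cfib that by (simp add: pairing_def natural_def natural_at_def)
    also have "\<dots> = eval2 B (commutator A u w) t q"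
      using dual_Sym2_sym [OF B fib cfib] that by (simp add: eval2_def)
    finally show "pairing (natural A B t) (commutator A u w) q
      = eval2 B (u \<cdot>\<^bsub>A\<^esub> w) t q - eval2 B (w \<cdot>\<^bsub>A\<^esub> u) t q" using * by simp
  qed
  \<comment> \<open>Moving \<open>N\<close> from the commutator to \<open>z\<close> produces exactly
    the commutator term of the coboundary at \<open>(x, y, N z)\<close> and avoids expanding
    \<open>N\<close> of a commutator.\<close>
  have twist_comm: "eval2 (twist A H B) (commutator A x y) z p = eval2 B (commutator A x y) (N z) p"
  proof -
    have "twist A H B p (commutator A x y p) (z p) = twist A H B p (z p) (commutator A x y p)"
      by (rule twist_sym [OF A H B cfib [OF x y] fib [OF z]])
    also have "\<dots> = B p (commutator A x y p) (N z p)"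
      unfolding twist_def N_def
      by (rule dual_Sym2_sym [OF B _ cfib [OF x y]])
         (rule Nmap_at_in_fibre [OF A H B fib [OF z]])
    finally show ?thesis by (simp add: eval2_def)
  qed
  note cl = closed N x y z
  have prod_sym: "eval2 B u (v \<cdot>\<^bsub>A\<^esub> w) = eval2 B (v \<cdot>\<^bsub>A\<^esub> w) u"
    if "u \<in> sections A" "v \<in> sections A" "w \<in> sections A" for u v w
    using that by (intro sym closed)
  \<comment> \<open>Symmetry is oriented case by case to fix one representative of each pair of
    arguments; \<open>prod_sym\<close> likewise puts products into the first slot.\<close>
  have flip: "eval2 B z x = eval2 B x z" "eval2 B z y = eval2 B y z" "eval2 B y x = eval2 B x y"
    "eval2 B y (N z) = eval2 B (N y) z" "eval2 B x (N z) = eval2 B (N x) z"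
    "eval2 B (N y) x = eval2 B (N x) y"
    using sym [OF z x] sym [OF z y] sym [OF y x] sym [OF y N [OF z]] sym [OF x N [OF z]]
      Nsym [OF z y] Nsym [OF z x] Nsym [OF y x] by auto
  show ?thesis
    unfolding coboundary_def twist_comm
    unfolding dual_KV_bracket_def dual_product_def Lie_derivative_def
      dual_right_mult_def algebroid_differential_def sharp twist
    by (simp add: cl pair pair_comm comm HN flip prod_sym)
qed

theorem theorem5p6:
  fixes A :: "('m::{t2_space, second_countable_topology}, 'v::real_vector) algebroid"
    and H :: "'m \<Rightarrow> ('v \<Rightarrow> real) \<Rightarrow> ('v \<Rightarrow> real) \<Rightarrow> real"
    and B :: "'m \<Rightarrow> 'v \<Rightarrow> 'v \<Rightarrow> real"
  assumes "left_symmetric_algebroid A"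
    and "Koszul_Vinberg_structure A H"
    and "B \<in> dual_Sym2 A"
  shows "KV_Omega_structure A H B \<longleftrightarrow>
    two_cocycle A B \<and> complementary_symmetric_2_tensor A H B"
proof -
  note B = assms(3)
  have A: "smooth_vector_bundle A"
    and "\<forall>x\<in>sections A. \<forall>y\<in>sections A. x \<cdot>\<^bsub>A\<^esub> y \<in> sections A"
    using assms(1) unfolding left_symmetric_algebroid_def by - (elim conjE, assumption)+
  then have closed: "x \<cdot>\<^bsub>A\<^esub> y \<in> sections A" if "x \<in> sections A" "y \<in> sections A" for x y
    using that by blast
  have H: "H \<in> Sym2 A" using assms(2) unfolding Koszul_Vinberg_structure_def by (rule conjunct1)
  \<comment> \<open>\<open>N\<close> preserves sections, so the cocycle condition may be applied
    with \<open>N\<close> inserted in any slot. As both sides of the equivalence contain the cocycle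
    condition on \<open>B\<close>, this equality compares their remaining conditions.\<close>
  have "dual_KV_bracket A H B x y z = coboundary A (twist A H B) x y z"
    if "two_cocycle A B" "x \<in> sections A" "y \<in> sections A" "z \<in> sections A" for x y z
  proof
    fix p
    show "dual_KV_bracket A H B x y z p = coboundary A (twist A H B) x y z p"
      using dual_KV_bracket_coboundary [OF A closed H B that(2-4), of p]
        Nmap_in_sections [OF A H B] that unfolding two_cocycle_def by simp
  qed
  then show ?thesis
    using assms(2) B twist_in_dual_Sym2 [OF A H B]
    unfolding KV_Omega_structure_def complementary_symmetric_2_tensor_def two_cocycle_def
    by auto
qed

end
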